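(* Let $h$ be a regularizer function on $\mathcal{C}$ and let $(\eta_t)_{t\in\mathbb{R}_+}$ be a positive, nonincreasing and piecewise continuous function. Then, for every measurable and locally integrable payoff stream $(u_t)_{t\in\mathbb{R}_+}$ in $V^*$, the process $x_t^c = Q_h\left(\eta_t\int_0^t u_s\,ds\right)$, $t\geq 0$, satisfies, for every $t\geq 0$ (with $x$ ranging over $\mathcal{C}$), $$\max_{x\in\mathcal{C}}\int_0^t\langle u_s | x\rangle\,ds-\int_0^t\langle u_s | x_s^c\rangle\,ds\leq\frac{h_{\max}-h_{\min}}{\eta_t}.$$
   Context: $V=\mathbb{R}^d$ is equipped with an arbitrary norm, $V^*$ is its dual, and $\langle y|x\rangle$ denotes the canonical pairing of $y\in V^*$ and $x\in V$. $\mathcal{C}\subset V$ is a nonempty compact convex set. A convex function $h:V\to\mathbb{R}\cup\{+\infty\}$ is a regularizer function on $\mathcal{C}$ if its effective domain $\{x : h(x)<\infty\}$ equals $\mathcal{C}$ and $h|_{\mathcal{C}}$ is strictly convex and continuous. The associated choice map $Q_h:V^*\to\mathcal{C}$ is $Q_h(y)=\arg\max_{x\in\mathcal{C}}\{\langle y|x\rangle-h(x)\}$ (the maximizer exists and is unique). $h_{\max}$ and $h_{\min}$ denote the maximum and minimum of $h$ over $\mathcal{C}$. *)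

theory Defs
  imports "HOL-Analysis.Analysis"
begin

text \<open>
  The space \<open>V\<close> with its arbitrary norm is a normed type \<open>'v\<close> that is spanned by a finite set; the
  Euclidean type classes are avoided because they would fix the norm. The dual \<open>V*\<close> is
  \<open>'v \<Rightarrow>\<^sub>L real\<close> with the operator norm, and the pairing of \<open>y\<close> and \<open>x\<close> is \<open>blinfun_apply y x\<close>.
\<close>

definition finite_dim_space :: "'v::real_vector itself \<Rightarrow> bool" where
  "finite_dim_space _ \<longleftrightarrow> (\<exists>B :: 'v set. finite B \<and> span B = UNIV)"

text \<open>Maximum and minimum over a set, as actual greatest and least values.\<close>

definition max_over :: "'a set \<Rightarrow> ('a \<Rightarrow> real) \<Rightarrow> real" where
  "max_over A f = (GREATEST m. m \<in> f ` A)"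

definition min_over :: "'a set \<Rightarrow> ('a \<Rightarrow> real) \<Rightarrow> real" where
  "min_over A f = (LEAST m. m \<in> f ` A)"

text \<open>Functions into \<open>\<real> \<union> {+\<infinity>}\<close> are \<open>ereal\<close>-valued functions that avoid \<open>-\<infinity>\<close>.\<close>

definition ext_convex :: "('v::real_vector \<Rightarrow> ereal) \<Rightarrow> bool" where
  "ext_convex h \<longleftrightarrow> (\<forall>x. h x \<noteq> -\<infinity>) \<and>
     (\<forall>x y. \<forall>r\<in>{0..1}. h ((1 - r) *\<^sub>R x + r *\<^sub>R y) \<le> ereal (1 - r) * h x + ereal r * h y)"

definition ext_strictly_convex_on :: "'v::real_vector set \<Rightarrow> ('v \<Rightarrow> ereal) \<Rightarrow> bool" where
  "ext_strictly_convex_on C h \<longleftrightarrow>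
     (\<forall>x\<in>C. \<forall>y\<in>C. x \<noteq> y \<longrightarrow> (\<forall>r\<in>{0<..<1}.
        h ((1 - r) *\<^sub>R x + r *\<^sub>R y) < ereal (1 - r) * h x + ereal r * h y))"

definition regularizer :: "'v::real_normed_vector set \<Rightarrow> ('v \<Rightarrow> ereal) \<Rightarrow> bool" where
  "regularizer C h \<longleftrightarrow>
     ext_convex h \<and> {x. h x < \<infinity>} = C \<and> ext_strictly_convex_on C h \<and> continuous_on C h"

definition choice_map ::
  "'v::real_normed_vector set \<Rightarrow> ('v \<Rightarrow> ereal) \<Rightarrow> ('v \<Rightarrow>\<^sub>L real) \<Rightarrow> 'v" where
  "choice_map C h y = arg_max (\<lambda>x. ereal (blinfun_apply y x) - h x) (\<lambda>x. x \<in> C)"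

text \<open>Functions on \<open>[0,\<infinity>)\<close> are functions on all reals of which only the values on \<open>{0..}\<close> matter.
  Piecewise continuity: finitely many discontinuities on each compact interval, with finite
  one-sided limits.\<close>

definition piecewise_continuous_halfline :: "(real \<Rightarrow> real) \<Rightarrow> bool" where
  "piecewise_continuous_halfline f \<longleftrightarrow>
     (\<forall>T>0. \<exists>S. finite S \<and> continuous_on ({0..T} - S) f) \<and>
     (\<forall>t\<ge>0. \<exists>l. (f \<longlongrightarrow> l) (at_right t)) \<and>
     (\<forall>t>0. \<exists>l. (f \<longlongrightarrow> l) (at_left t))"

text \<open>The Bochner integral of the library requires a second countable type class instance that the
  dual of a general normed type does not have. Lebesgue integrability is therefore stated as
  measurability and integrability of the norm, and integrals are written with the gauge integral
  \<open>integral\<close>, which agrees with the Lebesgue integral for such functions on a finite-dimensional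
  space.\<close>

definition measurable_locally_integrable :: "(real \<Rightarrow> 'b::real_normed_vector) \<Rightarrow> bool" where
  "measurable_locally_integrable u \<longleftrightarrow>
     u \<in> borel_measurable (lebesgue_on {0..}) \<and>
     (\<forall>T\<ge>0. set_integrable lebesgue {0..T} (\<lambda>s. norm (u s)))"

definition choice_process ::
  "'v::real_normed_vector set \<Rightarrow> ('v \<Rightarrow> ereal) \<Rightarrow> (real \<Rightarrow> real) \<Rightarrow> (real \<Rightarrow> 'v \<Rightarrow>\<^sub>L real) \<Rightarrow> real \<Rightarrow> 'v"
  where "choice_process C h \<eta> u t = choice_map C h (\<eta> t *\<^sub>R integral {0..t} u)"

end

theory Submission
  imports Defs
begin

text \<open>
  Let \<open>U s\<close> be the integral of \<open>u\<close> over \<open>[0,s]\<close> and let \<open>G s\<close> be the maximum over \<open>C\<close> of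
  \<open>\<langle>U s|x\<rangle> - (h x - h_min) / \<eta> s\<close>, which the choice process attains at \<open>X s\<close>. Comparing the
  maxima at \<open>r \<le> s\<close> through the point \<open>X s\<close>, where \<open>h \<ge> h_min\<close> and \<open>1 / \<eta>\<close> is nondecreasing,
  gives \<open>G s - G r \<le> \<langle>U s - U r|X s\<rangle>\<close>. As \<open>X\<close> is continuous off a
  finite set, summing over finer and finer grids yields
  \<open>G t - G 0 \<le> \<integral> \<langle>u s|X s\<rangle> ds\<close>, while \<open>G 0 \<le> 0\<close> and
  \<open>G t \<ge> \<langle>U t|x\<rangle> - (h_max - h_min) / \<eta> t\<close> for every \<open>x\<close> in \<open>C\<close>.
\<close>

section \<open>Finite-dimensional normed spaces: closed spans and coordinates on the dual\<close>

text \<open>Take \<open>d\<close> to be the distance from \<open>b\<close> to \<open>S\<close>,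
  positive because \<open>S\<close> is closed. For nonzero \<open>c\<close>, dividing
  \<open>s + c *\<^sub>R b\<close> by \<open>c\<close> leaves the difference of \<open>b\<close> and
  a point of \<open>S\<close>. This is the source of continuity for coordinates below.\<close>

lemma closed_subspace_coeff_bound:
  fixes S :: "'v::real_normed_vector set"
  assumes "subspace S" "closed S" "b \<notin> S"
  obtains d where "d > 0" "\<And>s c. s \<in> S \<Longrightarrow> \<bar>c\<bar> * d \<le> norm (s + c *\<^sub>R b)"
proof
  have ne: "S \<noteq> {}"
    using subspace_0[OF assms(1)] by blast
  show "infdist b S > 0"
    using assms in_closed_iff_infdist_zero[OF assms(2) ne] infdist_nonneg[of b S] by fastforce
  fix s c assume s: "s \<in> S"
  show "\<bar>c\<bar> * infdist b S \<le> norm (s + c *\<^sub>R b)"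
  proof (cases "c = 0")
    case False
    have "(- 1 / c) *\<^sub>R s \<in> S"
      by (rule subspace_scale[OF assms(1) s])
    then have "infdist b S \<le> dist b ((- 1 / c) *\<^sub>R s)"
      by (rule infdist_le)
    then have "\<bar>c\<bar> * infdist b S \<le> \<bar>c\<bar> * norm (b + (1 / c) *\<^sub>R s)"
      by (intro mult_left_mono) (auto simp: dist_norm)
    also have "\<dots> = norm (c *\<^sub>R (b + (1 / c) *\<^sub>R s))"
      by simp
    also have "c *\<^sub>R (b + (1 / c) *\<^sub>R s) = s + c *\<^sub>R b"
      using False by (simp add: scaleR_add_right)
    finally show ?thesis .
  qed simp
qed

text \<open>Along a convergent sequence in the larger span, the coefficients of the new vector
  \<open>b\<close> are Cauchy by the coefficient bound. They converge in the reals, so the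
  remainders converge in the span that is closed by induction.\<close>

lemma closed_span_finite:
  fixes B :: "'v::real_normed_vector set"
  assumes "finite B"
  shows "closed (span B)"
  using assms
proof induction
  case (insert b B)
  show ?case
  proof (cases "b \<in> span B")
    case True
    then show ?thesis
      using insert.IH by (simp add: span_redundant)
  next
    case False
    obtain d where d: "d > 0" "\<And>s c. s \<in> span B \<Longrightarrow> \<bar>c\<bar> * d \<le> norm (s + c *\<^sub>R b)"
      using closed_subspace_coeff_bound[OF subspace_span insert.IH False] by blast
    show ?thesis
      unfolding closed_sequential_limits
    proof (intro allI impI, elim conjE)
      fix x l assume x: "\<forall>n. x n \<in> span (insert b B)" and lim: "x \<longlonglongrightarrow> l"
      obtain k where k: "\<And>n. x n - k n *\<^sub>R b \<in> span B"
        using x unfolding span_breakdown_eq by metis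
      have diff: "\<bar>k m - k n\<bar> * d \<le> dist (x m) (x n)" for m n
        using d(2)[OF span_diff[OF k[of m] k[of n]], of "k m - k n"]
        by (simp add: dist_norm algebra_simps)
      have "Cauchy k"
      proof (rule metric_CauchyI)
        fix e :: real assume "e > 0"
        then obtain N where N: "\<forall>m\<ge>N. \<forall>n\<ge>N. dist (x m) (x n) < e * d"
          using metric_CauchyD[OF LIMSEQ_imp_Cauchy[OF lim], of "e * d"] d(1) by auto
        have "dist (k m) (k n) < e" if "m \<ge> N" "n \<ge> N" for m n
        proof -
          have "\<bar>k m - k n\<bar> * d < e * d"
            using diff[of m n] N that by (meson le_less_trans)
          then show ?thesis
            using d(1) by (simp add: dist_real_def)
        qed
        then show "\<exists>N. \<forall>m\<ge>N. \<forall>n\<ge>N. dist (k m) (k n) < e" by blast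
      qed
      then obtain c where c: "k \<longlonglongrightarrow> c"
        using Cauchy_convergent convergent_def by blast
      have "(\<lambda>n. x n - k n *\<^sub>R b) \<longlonglongrightarrow> l - c *\<^sub>R b"
        by (intro tendsto_intros lim c)
      then have "l - c *\<^sub>R b \<in> span B"
        using closed_sequentially[OF insert.IH, of "\<lambda>n. x n - k n *\<^sub>R b"] k by blast
      then show "l \<in> span (insert b B)"
        unfolding span_breakdown_eq by blast
    qed
  qed
qed simp

text \<open>The \<open>e b\<close> are the coordinate functionals of a basis \<open>B\<close>. The
  expansion reduces integrability of a dual-valued function to finitely many scalar
  functions.\<close>

lemma finite_dim_dual_expansion:
  assumes "finite_dim_space TYPE('v::real_normed_vector)"
  obtains B :: "'v::real_normed_vector set" and e :: "'v \<Rightarrow> 'v \<Rightarrow>\<^sub>L real"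
  where "finite B" "\<And>y. y = (\<Sum>b\<in>B. blinfun_apply y b *\<^sub>R e b)"
proof -
  obtain A :: "'v set" where A: "finite A" "span A = UNIV"
    using assms unfolding finite_dim_space_def by blast
  obtain B where B: "B \<subseteq> A" "independent B" "A \<subseteq> span B"
    using maximal_independent_subset by blast
  have fin: "finite B"
    using B(1) A(1) finite_subset by blast
  have sp: "span B = UNIV"
    using A(2) span_mono[OF B(3)] by (simp add: span_span top.extremum_unique)
  have sumrep: "(\<Sum>b\<in>B. representation B v b *\<^sub>R b) = v" for v
    using real_vector.sum_representation_eq[OF B(2) _ fin order_refl] sp by auto
  have bl: "bounded_linear (\<lambda>v. representation B v b)" if b: "b \<in> B" for b
  proof -
    \<comment> \<open>A coordinate is bounded because \<open>b\<close> has positive distance from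
      the closed span of the other basis vectors.\<close>
    have "b \<notin> span (B - {b})"
      using B(2) b unfolding dependent_def by blast
    then obtain d where d: "d > 0"
      "\<And>s c. s \<in> span (B - {b}) \<Longrightarrow> \<bar>c\<bar> * d \<le> norm (s + c *\<^sub>R b)"
      using closed_subspace_coeff_bound[OF subspace_span closed_span_finite] fin
      by (metis finite_Diff)
    show ?thesis
    proof (rule bounded_linear_intro[where K = "1 / d"])
      fix v
      have "(\<Sum>a\<in>B - {b}. representation B v a *\<^sub>R a) \<in> span (B - {b})"
        by (intro span_sum span_scale span_base)
      moreover have "(\<Sum>a\<in>B - {b}. representation B v a *\<^sub>R a) + representation B v b *\<^sub>R b = v"
        using sumrep[of v] sum.remove[OF fin b, of "\<lambda>a. representation B v a *\<^sub>R a"]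
        by (metis add.commute)
      ultimately show "norm (representation B v b) \<le> norm v * (1 / d)"
        using d by (metis real_norm_def mult.right_neutral pos_le_divide_eq times_divide_eq_right)
    qed (use sp B(2) in \<open>auto simp: real_vector.representation_add real_vector.representation_scale\<close>)
  qed
  show ?thesis
  proof
    show "finite B" by (rule fin)
    fix y :: "'v \<Rightarrow>\<^sub>L real"
    show "y = (\<Sum>b\<in>B. blinfun_apply y b *\<^sub>R Blinfun (\<lambda>v. representation B v b))"
    proof (rule blinfun_eqI)
      fix v
      have "blinfun_apply y v = blinfun_apply y (\<Sum>b\<in>B. representation B v b *\<^sub>R b)"
        by (simp add: sumrep)
      also have "\<dots> = blinfun_apply (\<Sum>b\<in>B. blinfun_apply y b *\<^sub>R Blinfun (\<lambda>v. representation B v b)) v"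
        by (simp add: blinfun.bilinear_simps blinfun.sum_left blinfun.sum_right
            bounded_linear_Blinfun_apply[OF bl] mult.commute)
      finally show "blinfun_apply y v = \<dots>" .
    qed
  qed
qed

section \<open>Integrability of the payoff stream\<close>

lemma measurable_locally_integrable_norm:
  assumes "measurable_locally_integrable u" "t \<ge> 0"
  shows "(\<lambda>s. norm (u s)) integrable_on {0..t}"
  using assms unfolding measurable_locally_integrable_def
  by (meson set_borel_integral_eq_integral(1) set_lebesgue_integral_eq_integral(1))

text \<open>Each scalar coordinate is measurable and dominated by
  \<open>norm (u s) * norm b\<close>; the dual expansion reassembles \<open>u\<close> from
  them.\<close>

lemma measurable_locally_integrable_integrable_on:
  fixes u :: "real \<Rightarrow> 'v::real_normed_vector \<Rightarrow>\<^sub>L real"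
  assumes "finite_dim_space TYPE('v)" "measurable_locally_integrable u" "t \<ge> 0"
  shows "u integrable_on {0..t}"
proof -
  obtain B :: "'v set" and e where B: "finite B"
    and e: "\<And>y. y = (\<Sum>b\<in>B. blinfun_apply y b *\<^sub>R e b)"
    using finite_dim_dual_expansion[OF assms(1)] by blast
  have app: "(\<lambda>s. blinfun_apply (u s) b) integrable_on {0..t}" for b
  proof (rule measurable_bounded_by_integrable_imp_integrable)
    have "u \<in> borel_measurable (lebesgue_on {0..})"
      using assms(2) unfolding measurable_locally_integrable_def by blast
    then have "(\<lambda>s. blinfun_apply (u s) b) \<in> borel_measurable (lebesgue_on {0..})"
      by (rule borel_measurable_continuous_on[rotated]) (intro continuous_intros)
    then show "(\<lambda>s. blinfun_apply (u s) b) \<in> borel_measurable (lebesgue_on {0..t})"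
      by (rule measurable_restrict_mono) auto
    show "(\<lambda>s. norm (u s) * norm b) integrable_on {0..t}"
      using measurable_locally_integrable_norm[OF assms(2,3)] by (rule integrable_on_mult_left)
    show "norm (blinfun_apply (u s) b) \<le> norm (u s) * norm b" for s
      by (rule norm_blinfun)
  qed simp
  have "(\<lambda>s. \<Sum>b\<in>B. blinfun_apply (u s) b *\<^sub>R e b) integrable_on {0..t}"
    by (intro integrable_sum B) (use integrable_linear[OF app bounded_linear_scaleR_left] in \<open>simp add: o_def\<close>)
  then show ?thesis
    using e by simp
qed

section \<open>Attained extrema, and the choice map: existence, uniqueness, continuity\<close>

lemma max_over_attained:
  fixes f :: "'a::topological_space \<Rightarrow> real"
  assumes "compact A" "A \<noteq> {}" "continuous_on A f"
  obtains x where "x \<in> A" "max_over A f = f x" "\<And>y. y \<in> A \<Longrightarrow> f y \<le> f x"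
proof -
  obtain x where x: "x \<in> A" "\<forall>y\<in>A. f y \<le> f x"
    using continuous_attains_sup[OF assms] by blast
  then have "max_over A f = f x"
    unfolding max_over_def by (intro Greatest_equality) auto
  with x that show thesis by blast
qed

lemma min_over_attained:
  fixes f :: "'a::topological_space \<Rightarrow> real"
  assumes "compact A" "A \<noteq> {}" "continuous_on A f"
  obtains x where "x \<in> A" "min_over A f = f x" "\<And>y. y \<in> A \<Longrightarrow> f x \<le> f y"
proof -
  obtain x where x: "x \<in> A" "\<forall>y\<in>A. f x \<le> f y"
    using continuous_attains_inf[OF assms] by blast
  then have "min_over A f = f x"
    unfolding min_over_def by (intro Least_equality) auto
  with x that show thesis by blast
qed

lemma regularizer_finite:
  assumes "regularizer C h" "x \<in> C"
  shows "\<bar>h x\<bar> \<noteq> \<infinity>"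
  using assms unfolding regularizer_def ext_convex_def by force

lemma regularizer_continuous_real:
  fixes C :: "'v::real_normed_vector set"
  assumes "regularizer C h"
  shows "continuous_on C (\<lambda>x. real_of_ereal (h x))"
proof -
  have "continuous_on C h"
    using assms unfolding regularizer_def by blast
  then show ?thesis
    using continuous_on_iff_real[of C h] regularizer_finite[OF assms] by (simp add: o_def)
qed

text \<open>\<open>arg_max\<close> is a choice operator, so its value is meaningful only once some
  maximizer exists; compactness and continuity provide one. Finiteness of \<open>h\<close> on
  \<open>C\<close> turns the extended-real comparison into a real one.\<close>

lemma choice_map_maximizer:
  fixes C :: "'v::real_normed_vector set"
  assumes C: "compact C" "C \<noteq> {}" and h: "regularizer C h"
  shows "choice_map C h y \<in> C"
    and "x \<in> C \<Longrightarrow> blinfun_apply y x - real_of_ereal (h x)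
      \<le> blinfun_apply y (choice_map C h y) - real_of_ereal (h (choice_map C h y))"
proof -
  let ?f = "\<lambda>x. ereal (blinfun_apply y x) - h x"
  have eq: "?f x = ereal (blinfun_apply y x - real_of_ereal (h x))" if "x \<in> C" for x
    using regularizer_finite[OF h that] by (cases "h x") auto
  have "continuous_on C (\<lambda>x. blinfun_apply y x - real_of_ereal (h x))"
    by (intro continuous_intros regularizer_continuous_real h)
  then obtain m where "m \<in> C"
    "\<forall>x\<in>C. blinfun_apply y x - real_of_ereal (h x) \<le> blinfun_apply y m - real_of_ereal (h m)"
    using continuous_attains_sup[OF C] by blast
  then have "is_arg_max ?f (\<lambda>x. x \<in> C) m"
    unfolding is_arg_max_def using eq by force
  then have *: "is_arg_max ?f (\<lambda>x. x \<in> C) (choice_map C h y)"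
    unfolding choice_map_def arg_max_def by (rule someI)
  then show 1: "choice_map C h y \<in> C"
    unfolding is_arg_max_def by blast
  show "blinfun_apply y x - real_of_ereal (h x)
      \<le> blinfun_apply y (choice_map C h y) - real_of_ereal (h (choice_map C h y))" if "x \<in> C"
    using * that eq[OF 1] eq[OF that] unfolding is_arg_max_def by force
qed

text \<open>By strict convexity, the midpoint of two distinct maximizers would have a strictly
  larger objective.\<close>

lemma regularizer_maximizer_unique:
  fixes C :: "'v::real_normed_vector set"
  assumes C: "convex C" and h: "regularizer C h" and a: "a \<in> C" and b: "b \<in> C"
    and max: "\<And>x. x \<in> C \<Longrightarrow>
      blinfun_apply y x - real_of_ereal (h x) \<le> blinfun_apply y a - real_of_ereal (h a)"
    and eq: "blinfun_apply y a - real_of_ereal (h a) \<le> blinfun_apply y b - real_of_ereal (h b)"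
  shows "a = b"
proof (rule ccontr)
  assume "a \<noteq> b"
  define m where "m = (1 - 1/2) *\<^sub>R a + (1/2 :: real) *\<^sub>R b"
  have m: "m \<in> C"
    unfolding m_def by (rule convexD_alt[OF C a b]) auto
  have "\<forall>r\<in>{0<..<1}. h ((1 - r) *\<^sub>R a + r *\<^sub>R b) < ereal (1 - r) * h a + ereal r * h b"
    using h a b \<open>a \<noteq> b\<close> unfolding regularizer_def ext_strictly_convex_on_def by blast
  from bspec[OF this, of "1/2"] have "h m < ereal (1 - 1/2) * h a + ereal (1/2) * h b"
    unfolding m_def by (simp only: greaterThanLessThan_iff) simp
  then have "real_of_ereal (h m) < real_of_ereal (h a) / 2 + real_of_ereal (h b) / 2"
    using regularizer_finite[OF h m] regularizer_finite[OF h a] regularizer_finite[OF h b]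
    by (cases "h m"; cases "h a"; cases "h b") auto
  moreover have "blinfun_apply y m = blinfun_apply y a / 2 + blinfun_apply y b / 2"
    unfolding m_def by (simp add: blinfun.bilinear_simps)
  ultimately show False
    using max[OF m] eq by linarith
qed

text \<open>Outside the \<epsilon>-ball around the maximizer the objective stays below its maximum
  by a positive gap. A small change of \<open>y\<close> moves the objective uniformly little on the
  bounded set \<open>C\<close>, so it cannot push the maximizer out of the ball.\<close>

lemma continuous_choice_map:
  fixes C :: "'v::real_normed_vector set"
  assumes C: "compact C" "C \<noteq> {}" "convex C" and h: "regularizer C h"
  shows "continuous_on UNIV (choice_map C h)"
  unfolding continuous_on_iff
proof (intro ballI allI impI)
  fix y :: "'v \<Rightarrow>\<^sub>L real" and \<epsilon> :: real
  assume "\<epsilon> > 0"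
  let ?f = "\<lambda>y x. blinfun_apply y x - real_of_ereal (h x)"
  let ?Q = "choice_map C h"
  define K where "K = C - ball (?Q y) \<epsilon>"
  note Q = choice_map_maximizer[OF C(1,2) h]
  show "\<exists>\<delta>>0. \<forall>y'\<in>UNIV. dist y' y < \<delta> \<longrightarrow> dist (?Q y') (?Q y) < \<epsilon>"
  proof (cases "K = {}")
    case True
    then have "dist (?Q y') (?Q y) < \<epsilon>" for y'
      using Q(1)[of y'] unfolding K_def by (auto simp: dist_commute)
    then show ?thesis
      by (intro exI[of _ 1]) auto
  next
    case False
    have "compact K"
      unfolding K_def by (intro compact_diff C) auto
    moreover have "continuous_on K (?f y)"
      by (rule continuous_on_subset[of C])
        (auto simp: K_def intro!: continuous_intros regularizer_continuous_real h)
    ultimately obtain k where k: "k \<in> K" "\<forall>x\<in>K. ?f y x \<le> ?f y k"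
      using continuous_attains_sup[OF _ False] by blast
    \<comment> \<open>If the gap vanished, \<open>k\<close> would be a second maximizer, hence equal
      to \<open>?Q y\<close>, although it lies outside the ball.\<close>
    have gap: "?f y k < ?f y (?Q y)"
    proof (rule ccontr)
      assume "\<not> ?thesis"
      then have "?Q y = k"
        using regularizer_maximizer_unique[OF C(3) h Q(1), of k y y] Q(2) k(1)
        unfolding K_def by force
      then show False
        using k(1) \<open>\<epsilon> > 0\<close> unfolding K_def by auto
    qed
    obtain R where R: "R > 0" "\<And>x. x \<in> C \<Longrightarrow> norm x \<le> R"
      using compact_imp_bounded[OF C(1)] unfolding bounded_pos by blast
    have near: "\<bar>?f y' x - ?f y x\<bar> \<le> dist y' y * R" if "x \<in> C" for x y'
    proof -
      have "\<bar>?f y' x - ?f y x\<bar> = norm (blinfun_apply (y' - y) x)"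
        by (simp add: blinfun.diff_left)
      also have "\<dots> \<le> norm (y' - y) * norm x"
        by (rule norm_blinfun)
      also have "\<dots> \<le> dist y' y * R"
        unfolding dist_norm using R(2)[OF that] by (intro mult_left_mono) auto
      finally show ?thesis .
    qed
    \<comment> \<open>Half the gap over \<open>R\<close>: the objective shifts by at most
      \<open>dist y' y * R\<close> at each of the two points \<open>?Q y\<close> and
      \<open>?Q y'\<close>.\<close>
    define \<delta> where "\<delta> = (?f y (?Q y) - ?f y k) / (2 * R)"
    have "dist (?Q y') (?Q y) < \<epsilon>" if "dist y' y < \<delta>" for y'
    proof (rule ccontr)
      assume "\<not> ?thesis"
      then have "?Q y' \<in> K"
        using Q(1)[of y'] unfolding K_def by (auto simp: dist_commute)
      then have "?f y (?Q y') \<le> ?f y k"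
        using k(2) by blast
      moreover have "2 * (dist y' y * R) < ?f y (?Q y) - ?f y k"
        using that R(1) unfolding \<delta>_def by (simp add: field_simps)
      ultimately show False
        using near[OF Q(1)[of y'], of y'] near[OF Q(1)[of y], of y'] Q(2)[OF Q(1)[of y], of y']
        by linarith
    qed
    moreover have "\<delta> > 0"
      using gap R(1) unfolding \<delta>_def by simp
    ultimately show ?thesis by blast
  qed
qed

section \<open>From increments on a grid to the integral\<close>

text \<open>Summing the increments of \<open>G\<close> over a uniform grid compares \<open>G t - G 0\<close> with the integral of
  \<open>u\<close> paired with a right-endpoint discretisation of \<open>X\<close>; dominated convergence removes the grid.\<close>

lemma increment_le_integral:
  fixes u :: "real \<Rightarrow> 'v::real_normed_vector \<Rightarrow>\<^sub>L real"
  assumes "t \<ge> 0" and u: "u integrable_on {0..t}" and nu: "(\<lambda>s. norm (u s)) integrable_on {0..t}"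
    and bX: "bounded (X ` {0..t})" and S: "finite S" and X: "continuous_on ({0..t} - S) X"
    and G: "\<And>r s. 0 \<le> r \<Longrightarrow> r \<le> s \<Longrightarrow> s \<le> t \<Longrightarrow>
      G s - G r \<le> blinfun_apply (integral {r..s} u) (X s)"
  shows "G t - G 0 \<le> integral {0..t} (\<lambda>s. blinfun_apply (u s) (X s))"
proof (cases "t = 0")
  case False
  then have t: "t > 0"
    using assms(1) by simp
  \<comment> \<open>\<open>p n s\<close> rounds \<open>s\<close> up to the grid of mesh
    \<open>t / real (Suc n)\<close>. Rounding goes up because the hypothesis on \<open>G\<close>
    evaluates \<open>X\<close> at the right endpoint.\<close>
  define p where "p n s = t * of_int \<lceil>real (Suc n) * s / t\<rceil> / real (Suc n)" for n s
  \<comment> \<open>Setting the integrands to 0 on the finite set \<open>S\<close> makes convergence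
    hold at every point without changing integrals.\<close>
  define f where "f n s = (if s \<in> S then 0 else blinfun_apply (u s) (X (p n s)))" for n s
  define g where "g s = (if s \<in> S then 0 else blinfun_apply (u s) (X s))" for s
  obtain R where R: "R > 0" "\<And>s. s \<in> {0..t} \<Longrightarrow> norm (X s) \<le> R"
    using bX unfolding bounded_pos by auto
  have p_lower: "s \<le> p n s" for n s
  proof -
    have "t * (real (Suc n) * s / t) \<le> t * of_int \<lceil>real (Suc n) * s / t\<rceil>"
      by (intro mult_left_mono le_of_int_ceiling) (use t in simp)
    then have "s * real (Suc n) \<le> t * of_int \<lceil>real (Suc n) * s / t\<rceil>"
      using t by (simp del: of_nat_Suc add: mult.commute)
    then show ?thesis
      unfolding p_def by (simp del: of_nat_Suc add: pos_le_divide_eq)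
  qed
  have p_upper: "p n s \<le> s + t / real (Suc n)" for n s
  proof -
    have "t * of_int \<lceil>real (Suc n) * s / t\<rceil> \<le> t * (real (Suc n) * s / t + 1)"
      by (intro mult_left_mono of_int_ceiling_le_add_one) (use t in simp)
    also have "\<dots> = (s + t / real (Suc n)) * real (Suc n)"
      using t by (simp del: of_nat_Suc add: distrib_left distrib_right mult.commute)
    finally show ?thesis
      unfolding p_def by (simp del: of_nat_Suc add: pos_divide_le_eq)
  qed
  have p_in: "p n s \<in> {0..t}" if "s \<in> {0..t}" for n s
  proof -
    have "real (Suc n) * s / t \<le> real_of_int (int (Suc n))"
      using that t by (simp del: of_nat_Suc add: pos_divide_le_eq mult_left_mono)
    then have "of_int \<lceil>real (Suc n) * s / t\<rceil> \<le> real_of_int (int (Suc n))"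
      by (simp only: of_int_le_iff ceiling_le_iff)
    then have "t * of_int \<lceil>real (Suc n) * s / t\<rceil> \<le> t * real (Suc n)"
      using t by (intro mult_left_mono) auto
    then have "p n s \<le> t"
      unfolding p_def by (simp add: field_simps)
    then show ?thesis
      using p_lower[of s n] that by auto
  qed
  \<comment> \<open>The existential \<open>I\<close> lets one induction over the cells carry both
    the integrability of \<open>f n\<close> and the telescoped bound.\<close>
  have grid: "\<exists>I. (f n has_integral I) {0..t * real i / real (Suc n)} \<and>
      G (t * real i / real (Suc n)) - G 0 \<le> I" if "i \<le> Suc n" for n i
    using that
  proof (induction i)
    case 0
    then show ?case by (intro exI[of _ 0]) auto
  next
    case (Suc i)
    let ?a = "t * real i / real (Suc n)" and ?b = "t * real (Suc i) / real (Suc n)"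
    obtain I where I: "(f n has_integral I) {0..?a}" "G ?a - G 0 \<le> I"
      using Suc by auto
    have ab: "0 \<le> ?a" "?a \<le> ?b"
      using t by (auto simp: field_simps)
    have bt: "?b \<le> t"
      using t Suc.prems by (simp add: field_simps del: of_nat_Suc)
    have "u integrable_on {?a..?b}"
      by (rule integrable_subinterval_real[OF u]) (use ab bt in auto)
    then have J: "((\<lambda>s. blinfun_apply (u s) (X ?b)) has_integral
        blinfun_apply (integral {?a..?b} u) (X ?b)) {?a..?b}"
      using has_integral_linear[OF integrable_integral blinfun.bounded_linear_left]
      by (simp add: o_def)
    \<comment> \<open>On the half-open cell the ceiling is constantly \<open>Suc i\<close>. The left
      endpoint \<open>?a\<close> belongs to the previous cell, and on \<open>S\<close> the function
      is 0; these finitely many points are spiked away.\<close>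
    have "f n s = blinfun_apply (u s) (X ?b)" if "s \<in> {?a..?b} - insert ?a S" for s
    proof -
      have "?a < s" "s \<le> ?b"
        using that by auto
      then have "real i < real (Suc n) * s / t" "real (Suc n) * s / t \<le> real (Suc i)"
        using t by (simp_all add: field_simps del: of_nat_Suc)
      then have "\<lceil>real (Suc n) * s / t\<rceil> = int (Suc i)"
        by (intro ceiling_unique) auto
      then show ?thesis
        using that unfolding f_def p_def by simp
    qed
    then have "(f n has_integral blinfun_apply (integral {?a..?b} u) (X ?b)) {?a..?b}"
      by (intro has_integral_spike_finite[OF _ _ J, of "insert ?a S"]) (use S in auto)
    from has_integral_combine[OF ab I(1) this]
    have "(f n has_integral I + blinfun_apply (integral {?a..?b} u) (X ?b)) {0..?b}" .
    moreover have "G ?b - G 0 \<le> I + blinfun_apply (integral {?a..?b} u) (X ?b)"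
      using G[OF ab bt] I(2) by linarith
    ultimately show ?case by blast
  qed
  have f: "f n integrable_on {0..t}" "G t - G 0 \<le> integral {0..t} (f n)" for n
  proof -
    have "t * real (Suc n) / real (Suc n) = t"
      by simp
    then obtain I where "(f n has_integral I) {0..t}" "G t - G 0 \<le> I"
      using grid[of "Suc n" n] by auto
    then show "f n integrable_on {0..t}" "G t - G 0 \<le> integral {0..t} (f n)"
      by (auto simp: has_integral_iff)
  qed
  have lim: "(\<lambda>n. f n s) \<longlonglongrightarrow> g s" if s: "s \<in> {0..t}" for s
  proof (cases "s \<in> S")
    case False
    have "(\<lambda>n. s + t / real (Suc n)) \<longlonglongrightarrow> s + 0"
      by (intro tendsto_intros LIMSEQ_Suc lim_const_over_n)
    then have ps: "(\<lambda>n. p n s) \<longlonglongrightarrow> s"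
      using real_tendsto_sandwich[of "\<lambda>_. s" "\<lambda>n. p n s" sequentially
          "\<lambda>n. s + t / real (Suc n)" s] p_lower p_upper by simp
    \<comment> \<open>Continuity of \<open>X\<close> is known only off \<open>S\<close>, so the grid
      points \<open>p n s\<close> must eventually avoid \<open>S\<close>.\<close>
    have "open (- S)"
      using S by (simp add: finite_imp_closed open_Compl)
    then have "\<forall>\<^sub>F n in sequentially. p n s \<in> - S"
      by (rule topological_tendstoD[OF ps]) (use False in simp)
    then have "\<forall>\<^sub>F n in sequentially. p n s \<in> {0..t} - S"
      by (rule eventually_mono) (use p_in[OF s] in auto)
    then have "(\<lambda>n. X (p n s)) \<longlonglongrightarrow> X s"
      using continuous_on_tendsto_compose[OF X ps] s False by auto
    then show ?thesis
      unfolding f_def g_def using False by (auto intro!: tendsto_intros)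
  qed (simp add: f_def g_def)
  have bound: "norm (f n s) \<le> norm (u s) * R" if "s \<in> {0..t}" for n s
  proof -
    have "norm (f n s) \<le> norm (u s) * norm (X (p n s))"
      unfolding f_def using norm_blinfun[of "u s" "X (p n s)"] by simp
    also have "\<dots> \<le> norm (u s) * R"
      using R(2)[OF p_in[OF that]] by (intro mult_left_mono) auto
    finally show ?thesis .
  qed
  have "(\<lambda>n. integral {0..t} (f n)) \<longlonglongrightarrow> integral {0..t} g"
    by (rule dominated_convergence(2)[OF f(1) integrable_on_mult_left[OF nu] bound lim])
  then have "G t - G 0 \<le> integral {0..t} g"
    by (rule Lim_bounded2) (use f(2) in auto)
  also have "integral {0..t} g = integral {0..t} (\<lambda>s. blinfun_apply (u s) (X s))"
    by (rule integral_spike[OF negligible_finite[OF S]]) (simp add: g_def)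
  finally show ?thesis .
qed simp

section \<open>The regret bound\<close>

theorem theorem4p1:
  fixes C :: "'v::real_normed_vector set"
    and h :: "'v \<Rightarrow> ereal"
    and \<eta> :: "real \<Rightarrow> real"
    and u :: "real \<Rightarrow> 'v \<Rightarrow>\<^sub>L real"
    and t :: real
  assumes "finite_dim_space TYPE('v)"
    and "C \<noteq> {}" and "compact C" and "convex C"
    and "regularizer C h"
    and "\<And>s. s \<ge> 0 \<Longrightarrow> \<eta> s > 0"
    and "\<And>r s. 0 \<le> r \<Longrightarrow> r \<le> s \<Longrightarrow> \<eta> s \<le> \<eta> r"
    and "piecewise_continuous_halfline \<eta>"
    and "measurable_locally_integrable u"
    and "t \<ge> 0"
  shows "max_over C (\<lambda>x. integral {0..t} (\<lambda>s. blinfun_apply (u s) x))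
         - integral {0..t} (\<lambda>s. blinfun_apply (u s) (choice_process C h \<eta> u s))
       \<le> (max_over C (\<lambda>x. real_of_ereal (h x)) - min_over C (\<lambda>x. real_of_ereal (h x))) / \<eta> t"
proof -
  define H where "H x = real_of_ereal (h x)" for x
  define U where "U s = integral {0..s} u" for s
  define X where "X s = choice_process C h \<eta> u s" for s
  have X_eq: "X s = choice_map C h (\<eta> s *\<^sub>R U s)" for s
    unfolding X_def choice_process_def U_def ..
  define hmin where "hmin = min_over C H"
  \<comment> \<open>Subtracting \<open>hmin\<close> makes the numerator nonnegative, so that
    monotonicity of \<open>\<eta>\<close> can be applied to the quotient.\<close>
  define G where "G s = blinfun_apply (U s) (X s) - (H (X s) - hmin) / \<eta> s" for s
  have u: "u integrable_on {0..s}" if "s \<ge> 0" for s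
    using measurable_locally_integrable_integrable_on[OF assms(1,9) that] .
  have contH: "continuous_on C H"
    using regularizer_continuous_real[OF assms(5)] unfolding H_def .
  obtain z where "z \<in> C" "min_over C H = H z" "\<And>y. y \<in> C \<Longrightarrow> H z \<le> H y"
    using min_over_attained[OF assms(3,2) contH] by metis
  then have hmin: "hmin \<le> H x" if "x \<in> C" for x
    using that unfolding hmin_def by simp
  have XC: "X s \<in> C" for s
    unfolding X_eq by (rule choice_map_maximizer[OF assms(3,2,5)])
  \<comment> \<open>Dividing the objective by \<open>\<eta> s > 0\<close> keeps its maximizer and
    moves the factor from \<open>U s\<close> to \<open>H\<close>.\<close>
  have X_max: "blinfun_apply (U s) x - H x / \<eta> s \<le> blinfun_apply (U s) (X s) - H (X s) / \<eta> s"
    if "s \<ge> 0" "x \<in> C" for s x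
  proof -
    have "\<eta> s * blinfun_apply (U s) x - H x \<le> \<eta> s * blinfun_apply (U s) (X s) - H (X s)"
      using choice_map_maximizer(2)[OF assms(3,2,5) that(2), of "\<eta> s *\<^sub>R U s"]
      unfolding X_eq H_def by (simp add: blinfun.scaleR_left)
    then have "(\<eta> s * blinfun_apply (U s) x - H x) / \<eta> s
        \<le> (\<eta> s * blinfun_apply (U s) (X s) - H (X s)) / \<eta> s"
      using assms(6)[OF that(1)] by (simp add: divide_right_mono)
    then show ?thesis
      using assms(6)[OF that(1)] by (simp add: diff_divide_distrib)
  qed
  \<comment> \<open>The interval reaches \<open>t + 1\<close> because piecewise continuity speaks of
    positive lengths, while \<open>t\<close> may be 0.\<close>
  have "\<exists>S. finite S \<and> continuous_on ({0..t + 1} - S) \<eta>"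
    using assms(8,10) unfolding piecewise_continuous_halfline_def
    by (metis add_nonneg_pos zero_less_one)
  then obtain S where S: "finite S" "continuous_on ({0..t} - S) \<eta>"
    by (metis Diff_mono atLeastatMost_subset_iff continuous_on_subset le_add_same_cancel1 order_refl zero_le_one)
  \<comment> \<open>Since \<open>U\<close> and the choice map are continuous, only discontinuities
    of \<open>\<eta>\<close> can pass to \<open>X\<close>.\<close>
  have "continuous_on {0..t} U"
    unfolding U_def by (rule indefinite_integral_continuous_1[OF u[OF assms(10)]])
  then have "continuous_on ({0..t} - S) (\<lambda>s. \<eta> s *\<^sub>R U s)"
    by (intro continuous_intros S(2)) (rule continuous_on_subset, auto)
  then have X: "continuous_on ({0..t} - S) X"
    unfolding X_eq
    by (rule continuous_on_compose2[OF continuous_choice_map[OF assms(3,2,4,5)]]) auto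
  have "G t - G 0 \<le> integral {0..t} (\<lambda>s. blinfun_apply (u s) (X s))"
  proof (rule increment_le_integral[OF assms(10) u[OF assms(10)] _ _ S(1) X])
    show "(\<lambda>s. norm (u s)) integrable_on {0..t}"
      by (rule measurable_locally_integrable_norm[OF assms(9,10)])
    show "bounded (X ` {0..t})"
      by (rule bounded_subset[OF compact_imp_bounded[OF assms(3)]]) (use XC in auto)
    fix r s assume rs: "0 \<le> r" "r \<le> s" "s \<le> t"
    have "integral {r..s} u = U s - U r"
      using Henstock_Kurzweil_Integration.integral_combine[OF rs(1,2) u] rs unfolding U_def by (simp add: algebra_simps)
    then have "blinfun_apply (integral {r..s} u) (X s)
        = blinfun_apply (U s) (X s) - blinfun_apply (U r) (X s)"
      by (simp add: blinfun.diff_left)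
    moreover have "(H (X s) - hmin) / \<eta> r \<le> (H (X s) - hmin) / \<eta> s"
      using assms(6)[of r] assms(6)[of s] assms(7)[OF rs(1,2)] rs hmin[OF XC[of s]]
      by (intro divide_left_mono) auto
    \<comment> \<open>The maximum at time \<open>r\<close> is tested with the later choice
      \<open>X s\<close>.\<close>
    ultimately show "G s - G r \<le> blinfun_apply (integral {r..s} u) (X s)"
      using X_max[OF rs(1) XC[of s]] unfolding G_def diff_divide_distrib by linarith
  qed
  \<comment> \<open>\<open>U 0\<close> vanishes, leaving only the nonpositive penalty term.\<close>
  moreover have "G 0 \<le> 0"
    using hmin[OF XC[of 0]] assms(6)[of 0] unfolding G_def U_def by simp
  moreover obtain x where x: "x \<in> C" "max_over C (blinfun_apply (U t)) = blinfun_apply (U t) x"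
    using max_over_attained[OF assms(3,2) linear_continuous_on[OF blinfun.bounded_linear_right]]
    by blast
  moreover have "blinfun_apply (U t) x - (max_over C H - hmin) / \<eta> t \<le> G t"
  proof -
    obtain z where "z \<in> C" "max_over C H = H z" "\<And>y. y \<in> C \<Longrightarrow> H y \<le> H z"
      using max_over_attained[OF assms(3,2) contH] by metis
    then have "H x \<le> max_over C H"
      using x(1) by simp
    then have "H x / \<eta> t \<le> max_over C H / \<eta> t"
      using assms(6)[OF assms(10)] by (simp add: divide_right_mono)
    then show ?thesis
      using X_max[OF assms(10) x(1)] unfolding G_def diff_divide_distrib by linarith
  qed
  \<comment> \<open>Pulling evaluation at \<open>x\<close> out of the integral identifies the
    maximized payoff with \<open>U t\<close>, whose maximizer over \<open>C\<close> was fixed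
    above.\<close>
  moreover have "integral {0..t} (\<lambda>s. blinfun_apply (u s) x) = blinfun_apply (U t) x" for x
    using integral_linear[OF u[OF assms(10)] blinfun.bounded_linear_left, of x]
    unfolding U_def by (simp add: o_def)
  ultimately show ?thesis
    unfolding hmin_def H_def X_def by simp
qed

end
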